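(* Let $G$ be a finite $2$-group, let $h\ge 2$ be an even integer and $r\ge 1$ an integer, and suppose $D^*(G)\cong X_{h,r}$. For every integer $t\ge 0$, define $G_t=G\times\mathbb Z_2^{\,t}$. Then $D^*(G_t)\cong X_{2^th,\,r}$.
   Context: All graphs are finite, simple and undirected. A finite $2$-group is a finite group whose order is a power of $2$; $e$ is the identity and $o(x)$ the order of $x$. For a finite group $G$, the Proper POE Complement Graph $D^*(G)$ has vertex set $G^*=G\setminus\{e\}$, and two distinct vertices $x,y$ are adjacent if and only if $o(xy)$ is not a prime number. For an even integer $h\ge 2$ and an integer $r\ge 1$, the graph $X_{h,r}$ is the join $$X_{h,r}=\overline{K}_{h-1}\vee\left(\bigvee_{i=1}^{r}\left(\tfrac h2\right)K_2\right),$$ where $\overline{K}_{h-1}$ is the edgeless graph on $h-1$ vertices, $\left(\frac h2\right)K_2$ is the disjoint union of $\frac h2$ copies of $K_2$, and the join $\vee$ of pairwise vertex-disjoint graphs is obtained from their disjoint union by adding all edges between vertices of different constituents. *)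

theory Defs
  imports
    "HOL-Computational_Algebra.Primes"
    "HOL-Algebra.Multiplicative_Group"
    "HOL-Algebra.Elementary_Groups"
    "HOL-Algebra.Product_Groups"
    "Graph_Theory.Graph_Theory"
begin

text \<open>
  A finite simple undirected graph is a \<open>pair_graph\<close> of the AFP entry Graph_Theory: a finite
  vertex set with a symmetric irreflexive set of ordered pairs, each undirected edge being
  represented by both of its orientations.
\<close>

abbreviation graph_iso :: "'a pair_pre_digraph \<Rightarrow> 'b pair_pre_digraph \<Rightarrow> bool"
    (infix \<open>\<cong>\<^sub>g\<close> 50) where
  "A \<cong>\<^sub>g B \<equiv> digraph_iso (with_proj A) (with_proj B)"

lemma graph_iso_iff:
  "A \<cong>\<^sub>g B \<longleftrightarrow> (\<exists>f. bij_betw f (pverts A) (pverts B) \<and>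
      (\<forall>x\<in>pverts A. \<forall>y\<in>pverts A. (x, y) \<in> parcs A \<longleftrightarrow> (f x, f y) \<in> parcs B))"
  if wfA: "pair_wf_digraph A" and wfB: "pair_wf_digraph B"
proof
  interpret A: pair_wf_digraph A by (fact wfA)
  assume "A \<cong>\<^sub>g B"
  then obtain h where h: "A.digraph_isomorphism h" and B: "with_proj B = app_iso h (with_proj A)"
    unfolding digraph_iso_def by auto
  have verts: "pverts B = iso_verts h ` pverts A"
    using arg_cong[OF B, of verts] by simp
  have arcs: "parcs B = iso_arcs h ` parcs A"
    using arg_cong[OF B, of arcs] by simp
  have th: "iso_tail h = fst" "iso_head h = snd"
    using arg_cong[OF B, of tail] arg_cong[OF B, of head] by simp_all
  have ends: "iso_arcs h a = (iso_verts h (fst a), iso_verts h (snd a))" if "a \<in> parcs A" for a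
  proof (rule prod_eqI)
    show "fst (iso_arcs h a) = fst (iso_verts h (fst a), iso_verts h (snd a))"
      using h that th by (auto simp: A.digraph_isomorphism_def)
    show "snd (iso_arcs h a) = snd (iso_verts h (fst a), iso_verts h (snd a))"
      using h that th by (auto simp: A.digraph_isomorphism_def)
  qed
  have inj: "inj_on (iso_verts h) (pverts A)"
    using h by (simp add: A.digraph_isomorphism_def)
  have "(x, y) \<in> parcs A \<longleftrightarrow> (iso_verts h x, iso_verts h y) \<in> parcs B"
    if "x \<in> pverts A" "y \<in> pverts A" for x y
  proof
    assume "(x, y) \<in> parcs A"
    then show "(iso_verts h x, iso_verts h y) \<in> parcs B"
      unfolding arcs using ends[of "(x, y)"] by (metis fst_conv snd_conv imageI)
  next
    assume "(iso_verts h x, iso_verts h y) \<in> parcs B"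
    then obtain a where a: "a \<in> parcs A" "(iso_verts h x, iso_verts h y) = iso_arcs h a"
      unfolding arcs by blast
    then have "iso_verts h x = iso_verts h (fst a)" "iso_verts h y = iso_verts h (snd a)"
      using ends by auto
    then have "x = fst a" "y = snd a"
      using inj that a(1) A.arc_fst_in_verts A.arc_snd_in_verts by (auto dest: inj_onD)
    then show "(x, y) \<in> parcs A" using a(1) by simp
  qed
  then show "\<exists>f. bij_betw f (pverts A) (pverts B) \<and>
      (\<forall>x\<in>pverts A. \<forall>y\<in>pverts A. (x, y) \<in> parcs A \<longleftrightarrow> (f x, f y) \<in> parcs B)"
    using inj verts by (auto simp: bij_betw_def intro!: exI[of _ "iso_verts h"])
next
  interpret A: pair_wf_digraph A by (fact wfA)
  interpret B: pair_wf_digraph B by (fact wfB)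
  assume "\<exists>f. bij_betw f (pverts A) (pverts B) \<and>
      (\<forall>x\<in>pverts A. \<forall>y\<in>pverts A. (x, y) \<in> parcs A \<longleftrightarrow> (f x, f y) \<in> parcs B)"
  then obtain f where inj: "inj_on f (pverts A)" and verts: "f ` pverts A = pverts B"
    and adj: "\<And>x y. x \<in> pverts A \<Longrightarrow> y \<in> pverts A \<Longrightarrow> (x, y) \<in> parcs A \<longleftrightarrow> (f x, f y) \<in> parcs B"
    by (auto simp: bij_betw_def)
  define h where "h = \<lparr>iso_verts = f, iso_arcs = map_prod f f, iso_head = snd, iso_tail = fst\<rparr>"
  have sub: "parcs A \<subseteq> pverts A \<times> pverts A"
    using A.in_arcsD1 A.in_arcsD2 by auto
  have "A.digraph_isomorphism h"
    unfolding A.digraph_isomorphism_def h_def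
    using A.wf_digraph inj inj_on_subset[OF map_prod_inj_on[OF inj inj] sub]
    by (auto simp: A.wf_digraph)
  moreover have "parcs B = map_prod f f ` parcs A"
  proof
    show "parcs B \<subseteq> map_prod f f ` parcs A"
    proof
      fix e assume "e \<in> parcs B"
      moreover from this obtain x y where "x \<in> pverts A" "y \<in> pverts A" "e = (f x, f y)"
        using B.arc_fst_in_verts B.arc_snd_in_verts verts by (metis imageE prod.collapse)
      ultimately show "e \<in> map_prod f f ` parcs A"
        using adj by force
    qed
    show "map_prod f f ` parcs A \<subseteq> parcs B"
      using sub adj by auto
  qed
  then have "with_proj B = app_iso h (with_proj A)"
    by (simp add: app_iso_def h_def with_proj_def verts)
  ultimately show "A \<cong>\<^sub>g B"
    unfolding digraph_iso_def by blast
qed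

definition edgeless_graph :: "nat \<Rightarrow> nat pair_pre_digraph" where
  "edgeless_graph n = \<lparr>pverts = {..<n}, parcs = {}\<rparr>"

definition complete_graph :: "nat \<Rightarrow> nat pair_pre_digraph" where
  "complete_graph n = \<lparr>pverts = {..<n}, parcs = {(x, y). x < n \<and> y < n \<and> x \<noteq> y}\<rparr>"

text \<open>Tagging every vertex with its index makes the constituents vertex-disjoint.\<close>

definition disjoint_union :: "'i set \<Rightarrow> ('i \<Rightarrow> 'a pair_pre_digraph) \<Rightarrow> ('i \<times> 'a) pair_pre_digraph" where
  "disjoint_union I \<Gamma> =
    \<lparr>pverts = (SIGMA i:I. pverts (\<Gamma> i)),
     parcs = {((i, x), (j, y)). i \<in> I \<and> j = i \<and> (x, y) \<in> parcs (\<Gamma> i)}\<rparr>"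

definition join_family :: "'i set \<Rightarrow> ('i \<Rightarrow> 'a pair_pre_digraph) \<Rightarrow> ('i \<times> 'a) pair_pre_digraph" where
  "join_family I \<Gamma> =
    \<lparr>pverts = pverts (disjoint_union I \<Gamma>),
     parcs = parcs (disjoint_union I \<Gamma>) \<union>
       {((i, x), (j, y)). i \<in> I \<and> j \<in> I \<and> i \<noteq> j \<and> x \<in> pverts (\<Gamma> i) \<and> y \<in> pverts (\<Gamma> j)}\<rparr>"

definition graph_join :: "'a pair_pre_digraph \<Rightarrow> 'b pair_pre_digraph \<Rightarrow> ('a + 'b) pair_pre_digraph"
    (infixr \<open>\<or>\<^sub>g\<close> 65) where
  "A \<or>\<^sub>g B =
    \<lparr>pverts = pverts A <+> pverts B,
     parcs = map_prod Inl Inl ` parcs A \<union> map_prod Inr Inr ` parcs B \<union>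
       (Inl ` pverts A) \<times> (Inr ` pverts B) \<union> (Inr ` pverts B) \<times> (Inl ` pverts A)\<rparr>"

definition X_graph :: "nat \<Rightarrow> nat \<Rightarrow> (nat + nat \<times> nat \<times> nat) pair_pre_digraph" where
  "X_graph h r =
    edgeless_graph (h - 1) \<or>\<^sub>g
    join_family {1..r} (\<lambda>i. disjoint_union {1..h div 2} (\<lambda>j. complete_graph 2))"

definition proper_POE_complement_graph :: "('a, 'b) monoid_scheme \<Rightarrow> 'a pair_pre_digraph" where
  "proper_POE_complement_graph G =
    \<lparr>pverts = carrier G - {\<one>\<^bsub>G\<^esub>},
     parcs = {(x, y). x \<in> carrier G - {\<one>\<^bsub>G\<^esub>} \<and> y \<in> carrier G - {\<one>\<^bsub>G\<^esub>} \<and> x \<noteq> y \<and>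
       \<not> prime (group.ord G (x \<otimes>\<^bsub>G\<^esub> y))}\<rparr>"

definition elementary_abelian_2_group :: "nat \<Rightarrow> (nat \<Rightarrow> int) monoid" where
  "elementary_abelian_2_group t = product_group {..<t} (\<lambda>_. integer_mod_group 2)"

lemma (in group) ord_mult_commute:
  assumes x: "x \<in> carrier G" and y: "y \<in> carrier G"
  shows "ord (x \<otimes> y) = ord (y \<otimes> x)"
proof -
  have pow: "(x \<otimes> y) [^] n \<otimes> x = x \<otimes> (y \<otimes> x) [^] n" for n :: nat
  proof (induction n)
    case (Suc n)
    have "(x \<otimes> y) [^] Suc n \<otimes> x = ((x \<otimes> y) [^] n \<otimes> x) \<otimes> (y \<otimes> x)"
      using x y by (simp add: m_assoc)
    also have "\<dots> = x \<otimes> (y \<otimes> x) [^] Suc n"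
      using x y by (simp add: Suc.IH m_assoc)
    finally show ?case .
  qed (use x in simp)
  have "(x \<otimes> y) [^] n = \<one> \<longleftrightarrow> (y \<otimes> x) [^] n = \<one>" for n :: nat
    using pow[of n] x y by (metis l_cancel_one' m_closed nat_pow_closed r_cancel_one')
  then show ?thesis
    by (simp add: ord_def)
qed

lemma pair_graph_proper_POE_complement_graph:
  assumes "group G" "finite (carrier G)"
  shows "pair_graph (proper_POE_complement_graph G)"
proof -
  have "finite (parcs (proper_POE_complement_graph G))"
    by (rule finite_subset[of _ "carrier G \<times> carrier G"])
       (use assms in \<open>auto simp: proper_POE_complement_graph_def\<close>)
  then show ?thesis
    using assms(2)
    by unfold_locales
       (auto simp: proper_POE_complement_graph_def symmetric_def group.ord_mult_commute[OF assms(1)]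
             intro!: symI)
qed

lemma pair_graph_X_graph: "pair_graph (X_graph h r)"
proof -
  have fin: "finite (pverts (X_graph h r))"
    by (auto simp: X_graph_def graph_join_def join_family_def disjoint_union_def
        edgeless_graph_def complete_graph_def)
  moreover have sub: "parcs (X_graph h r) \<subseteq> pverts (X_graph h r) \<times> pverts (X_graph h r)"
    by (auto simp: X_graph_def graph_join_def join_family_def disjoint_union_def
        edgeless_graph_def complete_graph_def)
  moreover have "finite (parcs (X_graph h r))"
    by (rule finite_subset[OF sub]) (use fin in simp)
  moreover have "sym (parcs (X_graph h r))"
    by (rule symI) (auto simp: X_graph_def graph_join_def join_family_def disjoint_union_def
        edgeless_graph_def complete_graph_def)
  moreover have "x \<noteq> y" if "(x, y) \<in> parcs (X_graph h r)" for x y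
    using that by (auto simp: X_graph_def graph_join_def join_family_def disjoint_union_def
        edgeless_graph_def complete_graph_def)
  ultimately show ?thesis
    by unfold_locales (auto simp: symmetric_def)
qed

end

theory Submission
  imports Defs "HOL-Algebra.Sylow"
begin

text \<open>
  In the complement of \<open>D\<^sup>*(G)\<close> the vertices \<open>x \<noteq> y\<close> are joined iff \<open>x y\<close> is an involution. Let \<open>T\<close> be
  the set of solutions of \<open>x\<^sup>2 = \<one>\<close>. The complement of \<open>X\<^bsub>h,r\<^esub>\<close> is a clique on \<open>h - 1\<close> vertices
  together with \<open>r\<close> cocktail-party graphs on \<open>h\<close> vertices. For a \<open>2\<close>-group, \<open>D\<^sup>*(G) \<cong> X\<^bsub>h,r\<^esub>\<close> holds iff
  \<open>T\<close> is a subgroup of order \<open>h\<close> and index \<open>r + 1\<close> containing all squares, and these conditions are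
  inherited by \<open>G \<times> \<int>\<^sub>2\<^sup>t\<close>. If they hold, then \<open>T - {\<one>}\<close> is the clique and every nontrivial
  coset of \<open>T\<close> is a cocktail-party graph whose missing edges are the pairs \<open>{x, x\<inverse>}\<close>. Conversely,
  the degrees in the complement force \<open>|T| = h\<close> and exponent dividing \<open>4\<close>, and no involution lies in a
  cocktail-party component on at least four vertices, so that all involutions lie in the clique.
\<close>

section \<open>The graph \<open>X_graph h r\<close> in coordinates\<close>

lemma pverts_X_graph:
  "pverts (X_graph h r) = {..<h - 1} <+> {1..r} \<times> {1..h div 2} \<times> {..<2}"
  by (auto simp: X_graph_def graph_join_def join_family_def disjoint_union_def
      edgeless_graph_def complete_graph_def)

lemma parcs_X_graph:
  "(Inl a, Inl b) \<notin> parcs (X_graph h r)"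
  "(Inl a, Inr p) \<in> parcs (X_graph h r) \<longleftrightarrow>
    Inl a \<in> pverts (X_graph h r) \<and> Inr p \<in> pverts (X_graph h r)"
  "(Inr p, Inl a) \<in> parcs (X_graph h r) \<longleftrightarrow>
    Inl a \<in> pverts (X_graph h r) \<and> Inr p \<in> pverts (X_graph h r)"
  "(Inr (i, j, b), Inr (i', j', b')) \<in> parcs (X_graph h r) \<longleftrightarrow>
    Inr (i, j, b) \<in> pverts (X_graph h r) \<and> Inr (i', j', b') \<in> pverts (X_graph h r) \<and>
    (i \<noteq> i' \<or> j = j' \<and> b \<noteq> b')"
  by (auto simp: X_graph_def graph_join_def join_family_def disjoint_union_def
      edgeless_graph_def complete_graph_def)

lemma card_pverts_X_graph:
  assumes "even h" "h \<ge> 2"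
  shows "card (pverts (X_graph h r)) = (r + 1) * h - 1"
proof -
  have "card (pverts (X_graph h r)) = (h - 1) + r * (h div 2 * 2)"
    unfolding pverts_X_graph by (subst card_Plus) (simp_all add: card_cartesian_product)
  also have "\<dots> = (r + 1) * h - 1"
    using assms by (simp add: dvd_div_mult_self)
  finally show ?thesis .
qed

section \<open>Complement neighbourhoods as isomorphism invariants\<close>

definition co_nbrs :: "'a pair_pre_digraph \<Rightarrow> 'a \<Rightarrow> 'a set" where
  "co_nbrs A u = {v \<in> pverts A. v \<noteq> u \<and> (u, v) \<notin> parcs A}"

text \<open>Distance exactly two in the complement: an arc of \<open>A\<close> rules out complement
  neighbours and, in a loopless graph, \<open>u\<close> itself.\<close>

definition co_dist2 :: "'a pair_pre_digraph \<Rightarrow> 'a \<Rightarrow> 'a set" where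
  "co_dist2 A u = {v \<in> pverts A. (u, v) \<in> parcs A \<and> co_nbrs A u \<inter> co_nbrs A v \<noteq> {}}"

lemma co_nbrs_iso:
  assumes f: "bij_betw f (pverts A) (pverts B)"
    and adj: "\<And>x y. x \<in> pverts A \<Longrightarrow> y \<in> pverts A \<Longrightarrow> (x, y) \<in> parcs A \<longleftrightarrow> (f x, f y) \<in> parcs B"
    and u: "u \<in> pverts A"
  shows "co_nbrs B (f u) = f ` co_nbrs A u"
proof -
  have inj: "inj_on f (pverts A)" and im: "pverts B = f ` pverts A"
    using f by (simp_all add: bij_betw_def)
  show ?thesis
    unfolding co_nbrs_def im using u inj by (auto simp: adj inj_on_eq_iff)
qed

lemma co_dist2_iso:
  assumes f: "bij_betw f (pverts A) (pverts B)"
    and adj: "\<And>x y. x \<in> pverts A \<Longrightarrow> y \<in> pverts A \<Longrightarrow> (x, y) \<in> parcs A \<longleftrightarrow> (f x, f y) \<in> parcs B"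
    and u: "u \<in> pverts A"
  shows "co_dist2 B (f u) = f ` co_dist2 A u"
proof -
  have inter: "co_nbrs B (f u) \<inter> co_nbrs B (f v) = f ` (co_nbrs A u \<inter> co_nbrs A v)"
    if "v \<in> pverts A" for v
  proof -
    have "co_nbrs A u \<subseteq> pverts A" "co_nbrs A v \<subseteq> pverts A"
      by (auto simp: co_nbrs_def)
    then show ?thesis
      using f u that by (simp add: co_nbrs_iso[OF f adj] bij_betw_def inj_on_image_Int[of f "pverts A"])
  qed
  have im: "pverts B = f ` pverts A" using f by (simp add: bij_betw_def)
  have "co_dist2 B (f u) = f ` {v \<in> pverts A. (f u, f v) \<in> parcs B \<and>
      co_nbrs B (f u) \<inter> co_nbrs B (f v) \<noteq> {}}"
    unfolding co_dist2_def im by blast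
  also have "\<dots> = f ` co_dist2 A u"
    unfolding co_dist2_def using inter u
    by (intro arg_cong[where f = "(`) f"] Collect_cong) (auto simp: adj)
  finally show ?thesis .
qed

lemma co_nbrs_X_graph_Inl:
  assumes "Inl a \<in> pverts (X_graph h r)"
  shows "co_nbrs (X_graph h r) (Inl a) = Inl ` ({..<h - 1} - {a})"
  using assms unfolding co_nbrs_def by (auto simp: pverts_X_graph parcs_X_graph)

lemma co_nbrs_X_graph_Inr:
  assumes "Inr (i, j, b) \<in> pverts (X_graph h r)"
  shows "co_nbrs (X_graph h r) (Inr (i, j, b)) = Inr ` ({i} \<times> ({1..h div 2} - {j}) \<times> {..<2})"
  using assms unfolding co_nbrs_def by (auto simp: pverts_X_graph parcs_X_graph image_iff)

text \<open>A clique vertex misses only itself among \<open>h - 1\<close> vertices, a cocktail-party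
  vertex misses its whole pair among \<open>h\<close>. The complement is thus regular, so degrees
  cannot tell the two kinds apart; \<open>co_dist2\<close> has to do it.\<close>

lemma card_co_nbrs_X_graph:
  assumes "even h" "u \<in> pverts (X_graph h r)"
  shows "card (co_nbrs (X_graph h r) u) = h - 2"
proof (cases u)
  case (Inl a)
  then show ?thesis using assms
    by (simp add: co_nbrs_X_graph_Inl card_image) (auto simp: pverts_X_graph)
next
  case (Inr p)
  obtain i j b where "p = (i, j, b)" by (cases p)
  then show ?thesis using assms Inr
    by (simp add: co_nbrs_X_graph_Inr card_image card_cartesian_product)
      (auto simp: pverts_X_graph)
qed

text \<open>In a clique nothing is at distance two; in a cocktail-party graph only the other end
  \<open>1 - b\<close> of the same pair can be.\<close>

lemma co_dist2_X_graph_unique: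
  assumes "u \<in> pverts (X_graph h r)" "v \<in> co_dist2 (X_graph h r) u" "w \<in> co_dist2 (X_graph h r) u"
  shows "v = w"
proof -
  have key: "\<exists>i j b. u = Inr (i, j, b) \<and> x = Inr (i, j, 1 - b)"
    if x: "x \<in> co_dist2 (X_graph h r) u" for x
  proof -
    have xv: "x \<in> pverts (X_graph h r)" and ux: "(u, x) \<in> parcs (X_graph h r)"
      and ne: "co_nbrs (X_graph h r) u \<inter> co_nbrs (X_graph h r) x \<noteq> {}"
      using x by (auto simp: co_dist2_def)
    show ?thesis
    proof (cases u)
      case (Inl a)
      with ux obtain p where "x = Inr p" by (cases x) (auto simp: parcs_X_graph)
      moreover obtain i j b where "p = (i, j, b)" by (cases p)
      ultimately show ?thesis
        using ne xv assms(1) Inl by (auto simp: co_nbrs_X_graph_Inl co_nbrs_X_graph_Inr)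
    next
      case (Inr p)
      obtain i j b where p: "p = (i, j, b)" by (cases p)
      show ?thesis
      proof (cases x)
        case (Inl a)
        then show ?thesis
          using ne xv assms(1) Inr p by (auto simp: co_nbrs_X_graph_Inl co_nbrs_X_graph_Inr)
      next
        case (Inr q)
        obtain i' j' b' where q: "q = (i', j', b')" by (cases q)
        have "i' = i"
          using ne xv assms(1) Inr \<open>u = Inr p\<close> p q by (auto simp: co_nbrs_X_graph_Inr)
        moreover from this have "j = j'" "b \<noteq> b'"
          using ux Inr \<open>u = Inr p\<close> p q by (auto simp: parcs_X_graph)
        moreover have "b < 2" "b' < 2"
          using xv assms(1) Inr \<open>u = Inr p\<close> p q by (auto simp: pverts_X_graph)
        ultimately show ?thesis
          using Inr \<open>u = Inr p\<close> p q by auto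
      qed
    qed
  qed
  show ?thesis using key[OF assms(2)] key[OF assms(3)] by auto
qed

text \<open>With \<open>h \<ge> 4\<close> a component has a second pair \<open>k\<close>, whose
  vertices are common neighbours of both ends of pair \<open>j\<close>. For \<open>h = 2\<close> a
  component is two isolated vertices and the criterion fails.\<close>

lemma co_dist2_X_graph_empty:
  assumes "h \<ge> 4" "u \<in> pverts (X_graph h r)" "co_dist2 (X_graph h r) u = {}"
  shows "u \<in> range Inl"
proof (cases u)
  case (Inr p)
  obtain i j b where p: "p = (i, j, b)" by (cases p)
  have ver: "i \<in> {1..r}" "j \<in> {1..h div 2}" "b < 2"
    using assms(2) Inr p by (auto simp: pverts_X_graph)
  have "\<exists>k\<in>{1..h div 2}. k \<noteq> j"
    using assms(1) by (intro bexI[of _ "if j = 1 then 2 else 1"]) auto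
  then obtain k where k: "k \<in> {1..h div 2}" "k \<noteq> j" by blast
  have v: "Inr (i, j, 1 - b) \<in> pverts (X_graph h r)"
    using ver by (auto simp: pverts_X_graph)
  have "Inr (i, k, 0) \<in> co_nbrs (X_graph h r) u \<inter> co_nbrs (X_graph h r) (Inr (i, j, 1 - b))"
    using k v assms(2) Inr p by (simp add: co_nbrs_X_graph_Inr)
  moreover have "(u, Inr (i, j, 1 - b)) \<in> parcs (X_graph h r)"
    using v assms(2) Inr p ver by (auto simp: parcs_X_graph) presburger
  ultimately have "Inr (i, j, 1 - b) \<in> co_dist2 (X_graph h r) u"
    using v unfolding co_dist2_def by blast
  then show ?thesis using assms(3) by simp
qed simp

section \<open>Square roots of the identity and adjacency in the POE complement graph\<close>

definition two_torsion :: "('a, 'b) monoid_scheme \<Rightarrow> 'a set" where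
  "two_torsion G = {x \<in> carrier G. x \<otimes>\<^bsub>G\<^esub> x = \<one>\<^bsub>G\<^esub>}"

text \<open>Elements of \<open>two_torsion G\<close> are their own inverses, so closure under
  products already makes it a subgroup.\<close>

definition poe_structure :: "('a, 'b) monoid_scheme \<Rightarrow> nat \<Rightarrow> nat \<Rightarrow> bool" where
  "poe_structure G h r \<longleftrightarrow>
    (\<forall>x\<in>two_torsion G. \<forall>y\<in>two_torsion G. x \<otimes>\<^bsub>G\<^esub> y \<in> two_torsion G) \<and>
    (\<forall>x\<in>carrier G. x \<otimes>\<^bsub>G\<^esub> x \<in> two_torsion G) \<and>
    card (two_torsion G) = h \<and> order G = (r + 1) * h"

context group
begin

text \<open>The order divides a power of 2, so 2 is the only prime it can be. Bounding the exponent
  instead of the group order lets the converse direction use exponent 4.\<close>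

lemma prime_ord_two_power:
  assumes x: "x \<in> carrier G" and n: "x [^] (2 ^ n :: nat) = \<one>"
  shows "prime (ord x) \<longleftrightarrow> x \<in> two_torsion G \<and> x \<noteq> \<one>"
proof
  assume p: "prime (ord x)"
  have "ord x dvd 2 ^ n" using n x pow_eq_id by blast
  then have "ord x dvd 2" using p prime_dvd_power by blast
  then have "ord x = 2" using p primes_dvd_imp_eq two_is_prime_nat by blast
  then have "x [^] (2::nat) = \<one>" "x \<noteq> \<one>"
    using pow_ord_eq_1[OF x] by auto
  then show "x \<in> two_torsion G \<and> x \<noteq> \<one>"
    using x by (simp add: two_torsion_def numeral_2_eq_2)
next
  assume a: "x \<in> two_torsion G \<and> x \<noteq> \<one>"
  then have "x [^] (2::nat) = \<one>" using x by (simp add: two_torsion_def numeral_2_eq_2)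
  then have "ord x dvd 2" using pow_eq_id x by blast
  moreover have "ord x \<noteq> 1" using a x ord_eq_1 by blast
  ultimately have "ord x = 2" using prime_nat_iff two_is_prime_nat by blast
  then show "prime (ord x)" by simp
qed

lemma two_torsion_inv: "x \<in> two_torsion G \<Longrightarrow> inv x = x"
  by (auto simp: two_torsion_def intro: inv_equality)

text \<open>The two products are conjugate by \<open>x\<close>.\<close>

lemma two_torsion_commute:
  assumes "x \<in> carrier G" "y \<in> carrier G" "x \<otimes> y \<in> two_torsion G"
  shows "y \<otimes> x \<in> two_torsion G"
proof -
  have "x \<otimes> ((y \<otimes> x) \<otimes> (y \<otimes> x)) = ((x \<otimes> y) \<otimes> (x \<otimes> y)) \<otimes> x"
    using assms(1,2) by (simp add: m_assoc)
  also have "\<dots> = x" using assms by (simp add: two_torsion_def)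
  finally have "(y \<otimes> x) \<otimes> (y \<otimes> x) = \<one>"
    using assms(1,2) by (simp)
  then show ?thesis using assms by (simp add: two_torsion_def)
qed

lemma mult_eq_one_iff:
  assumes "x \<in> carrier G" "y \<in> carrier G"
  shows "x \<otimes> y = \<one> \<longleftrightarrow> y = inv x"
  using assms by (metis inv_comm inv_equality r_inv)

lemma one_two_torsion: "\<one> \<in> two_torsion G"
  by (simp add: two_torsion_def)

lemma two_torsion_subset: "two_torsion G \<subseteq> carrier G"
  by (auto simp: two_torsion_def)

lemma inv_in_two_torsion_iff:
  "x \<in> carrier G \<Longrightarrow> inv x \<in> two_torsion G \<longleftrightarrow> x \<in> two_torsion G"
  using two_torsion_inv by (metis inv_inv)

lemma two_torsion_conj:
  assumes "z \<in> two_torsion G" "s \<in> two_torsion G"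
  shows "z \<otimes> s \<otimes> z \<in> two_torsion G"
proof -
  have [simp]: "z \<in> carrier G" "s \<in> carrier G" "z \<otimes> z = \<one>" "s \<otimes> s = \<one>"
    using assms by (auto simp: two_torsion_def)
  have "(z \<otimes> s \<otimes> z) \<otimes> (z \<otimes> s \<otimes> z) = z \<otimes> (s \<otimes> ((z \<otimes> z) \<otimes> s)) \<otimes> z"
    by (simp only: m_assoc m_closed \<open>z \<in> carrier G\<close> \<open>s \<in> carrier G\<close>)
  then show ?thesis by (simp add: two_torsion_def)
qed

text \<open>The identity is in \<open>two_torsion G\<close> but has order 1, which is not prime;
  hence the exception that joins a vertex to its inverse.\<close>

lemma parcs_POE:
  assumes exp: "\<forall>x\<in>carrier G. x [^] (2 ^ n :: nat) = \<one>"
    and "x \<in> carrier G - {\<one>}" "y \<in> carrier G - {\<one>}"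
  shows "(x, y) \<in> parcs (proper_POE_complement_graph G) \<longleftrightarrow>
    x \<noteq> y \<and> (x \<otimes> y \<in> two_torsion G \<longrightarrow> x \<otimes> y = \<one>)"
  using assms(2,3) prime_ord_two_power[of "x \<otimes> y" n] exp
  by (auto simp: proper_POE_complement_graph_def)

lemma pverts_POE: "pverts (proper_POE_complement_graph G) = carrier G - {\<one>}"
  by (simp add: proper_POE_complement_graph_def)

lemma co_nbrs_POE:
  assumes exp: "\<forall>x\<in>carrier G. x [^] (2 ^ n :: nat) = \<one>"
    and x: "x \<in> carrier G - {\<one>}"
  shows "co_nbrs (proper_POE_complement_graph G) x =
    {y \<in> carrier G - {\<one>}. y \<noteq> x \<and> x \<otimes> y \<in> two_torsion G \<and> x \<otimes> y \<noteq> \<one>}"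
  using x unfolding co_nbrs_def pverts_POE by (auto simp: parcs_POE[OF exp])

text \<open>Left multiplication by \<open>x\<close> carries the complement neighbours
  \<open>y\<close> into \<open>two_torsion G\<close>; the values \<open>\<one>\<close>,
  \<open>x\<close> and \<open>x \<otimes> x\<close> are lost because \<open>y\<close> differs from
  \<open>inv x\<close>, \<open>\<one>\<close> and \<open>x\<close> respectively.\<close>

lemma card_co_nbrs_POE:
  assumes exp: "\<forall>x\<in>carrier G. x [^] (2 ^ n :: nat) = \<one>"
    and x: "x \<in> carrier G - {\<one>}"
  shows "card (co_nbrs (proper_POE_complement_graph G) x) =
    card (two_torsion G - {\<one>, x, x \<otimes> x})"
proof -
  have "bij_betw (\<lambda>y. x \<otimes> y) (co_nbrs (proper_POE_complement_graph G) x)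
    (two_torsion G - {\<one>, x, x \<otimes> x})"
    unfolding co_nbrs_POE[OF exp x]
  proof (rule bij_betwI[where g = "\<lambda>s. inv x \<otimes> s"])
    show "(\<lambda>s. inv x \<otimes> s) \<in> two_torsion G - {\<one>, x, x \<otimes> x} \<rightarrow>
      {y \<in> carrier G - {\<one>}. y \<noteq> x \<and> x \<otimes> y \<in> two_torsion G \<and> x \<otimes> y \<noteq> \<one>}"
    proof
      fix s assume s: "s \<in> two_torsion G - {\<one>, x, x \<otimes> x}"
      then have sc: "s \<in> carrier G" using two_torsion_subset by auto
      have eq: "x \<otimes> (inv x \<otimes> s) = s" using x sc by (simp add: m_assoc[symmetric])
      have "inv x \<otimes> s \<noteq> \<one>" "inv x \<otimes> s \<noteq> x"
        using s eq x by auto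
      then show "inv x \<otimes> s \<in>
          {y \<in> carrier G - {\<one>}. y \<noteq> x \<and> x \<otimes> y \<in> two_torsion G \<and> x \<otimes> y \<noteq> \<one>}"
        using s eq x sc by auto
    qed
  qed (use x two_torsion_subset in \<open>auto simp: m_assoc[symmetric] l_cancel_one' r_cancel_one'\<close>)
  then show ?thesis by (rule bij_betw_same_card)
qed

text \<open>Cauchy's theorem for the prime 2, read off from a Sylow subgroup of order
  \<open>2 ^ 1\<close>.\<close>

lemma exists_involution:
  assumes "finite (carrier G)" "even (order G)"
  obtains z where "z \<in> two_torsion G" "z \<noteq> \<one>"
proof -
  obtain m where "order G = 2 ^ 1 * m" using assms(2) by auto
  then obtain H where H: "subgroup H G" "card H = 2"
    using sylow_thm[of 2 G 1 m] assms(1) is_group by auto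
  interpret H: subgroup H G by (fact H(1))
  obtain z where z: "H = {\<one>, z}" "z \<noteq> \<one>"
    using H(2) H.one_closed by (metis card_2_iff insertE insert_commute singletonD)
  have "z \<in> carrier G" using z H.subset by auto
  moreover have "z \<otimes> z \<in> H" using H.m_closed[of z z] z(1) by blast
  ultimately have "z \<otimes> z = \<one>" using z l_cancel_one' by auto
  then show ?thesis using that[of z] z(2) \<open>z \<in> carrier G\<close> by (simp add: two_torsion_def)
qed

text \<open>The map \<open>y \<mapsto> z y\<inverse> z\<close> is an automorphism of the graph fixing \<open>z\<close>. If there were exactly one
  vertex \<open>y\<close> at distance two from \<open>z\<close> in the complement, it would be fixed too; but then
  \<open>(z y)\<^sup>2 = \<one>\<close>, so \<open>y\<close> would be at distance one.\<close>

lemma co_dist2_involution_empty: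
  assumes exp: "\<forall>x\<in>carrier G. x [^] (2 ^ n :: nat) = \<one>"
    and z: "z \<in> two_torsion G" "z \<noteq> \<one>"
    and unique: "\<And>v w. v \<in> co_dist2 (proper_POE_complement_graph G) z \<Longrightarrow>
      w \<in> co_dist2 (proper_POE_complement_graph G) z \<Longrightarrow> v = w"
  shows "co_dist2 (proper_POE_complement_graph G) z = {}"
proof (rule ccontr)
  let ?D = "proper_POE_complement_graph G"
  assume "co_dist2 ?D z \<noteq> {}"
  then obtain y where y: "y \<in> co_dist2 ?D z" by blast
  have zc[simp]: "z \<in> carrier G" and zz: "z \<otimes> z = \<one>" and iz: "inv z = z"
    using z two_torsion_inv by (auto simp: two_torsion_def)
  have zv: "z \<in> carrier G - {\<one>}" using z by simp
  have yc: "y \<in> carrier G - {\<one>}" and zy: "(z, y) \<in> parcs ?D"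
    using y by (auto simp: co_dist2_def pverts_POE)
  obtain w where wz: "w \<in> co_nbrs ?D z" and wy: "w \<in> co_nbrs ?D y"
    using y by (auto simp: co_dist2_def)
  have wc: "w \<in> carrier G - {\<one>}" and "w \<noteq> z" and zw: "z \<otimes> w \<in> two_torsion G" "z \<otimes> w \<noteq> \<one>"
    using wz co_nbrs_POE[OF exp zv] by auto
  have "w \<noteq> y" and yw: "y \<otimes> w \<in> two_torsion G" "y \<otimes> w \<noteq> \<one>"
    using wy co_nbrs_POE[OF exp yc] by auto
  define \<sigma> where "\<sigma> = (\<lambda>a. z \<otimes> inv a \<otimes> z)"
  have \<sigma>c: "\<sigma> a \<in> carrier G" if "a \<in> carrier G" for a using that by (simp add: \<sigma>_def)
  \<comment> \<open>As inversion preserves \<open>two_torsion G\<close>, this identity shows that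
    \<open>\<sigma>\<close> preserves adjacency to \<open>z\<close>.\<close>
  have z\<sigma>: "z \<otimes> \<sigma> a = inv (z \<otimes> a)" if "a \<in> carrier G" for a
    using that by (simp add: \<sigma>_def m_assoc[symmetric] zz inv_mult_group iz)
  have \<sigma>inj: "\<sigma> a = \<sigma> b \<longleftrightarrow> a = b" if "a \<in> carrier G" "b \<in> carrier G" for a b
    using that by (metis z\<sigma> inv_inv Units_eq Units_l_cancel m_closed zc)
  have \<sigma>z: "\<sigma> z = z" and \<sigma>1: "\<sigma> \<one> = \<one>" by (simp_all add: \<sigma>_def zz iz)
  have \<sigma>v: "\<sigma> a \<in> carrier G - {\<one>}" if "a \<in> carrier G - {\<one>}" for a
    using that \<sigma>c \<sigma>inj[of a \<one>] \<sigma>1 by auto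
  have "z \<noteq> y" using zy by (simp add: parcs_POE[OF exp zv yc])
  then have "z \<otimes> y \<noteq> \<one>" using yc iz by (simp add: mult_eq_one_iff)
  then have nzy: "z \<otimes> y \<notin> two_torsion G"
    using zy by (simp add: parcs_POE[OF exp zv yc])
  have "(z, \<sigma> y) \<in> parcs ?D"
    using nzy yc \<open>z \<noteq> y\<close> \<sigma>inj[of z y] \<sigma>z
    by (simp add: parcs_POE[OF exp zv \<sigma>v[OF yc]] z\<sigma> inv_in_two_torsion_iff)
  moreover have "\<sigma> w \<in> co_nbrs ?D z"
    unfolding co_nbrs_POE[OF exp zv]
    using \<sigma>v[OF wc] zw wc \<open>w \<noteq> z\<close> \<sigma>inj[of w z] \<sigma>z
    by (simp add: z\<sigma> inv_in_two_torsion_iff inv_eq_1_iff)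
  moreover have "\<sigma> w \<in> co_nbrs ?D (\<sigma> y)"
  proof -
    \<comment> \<open>Inversion followed by conjugation with \<open>z\<close> reverses products, so
      \<open>w \<otimes> y\<close> appears and \<open>two_torsion_commute\<close> is needed.\<close>
    have "\<sigma> y \<otimes> \<sigma> w = z \<otimes> (inv y \<otimes> ((z \<otimes> z) \<otimes> inv w)) \<otimes> z"
      using yc wc by (simp add: \<sigma>_def m_assoc)
    also have "\<dots> = \<sigma> (w \<otimes> y)"
      using yc wc by (simp add: zz \<sigma>_def inv_mult_group)
    finally have eq: "\<sigma> y \<otimes> \<sigma> w = \<sigma> (w \<otimes> y)" .
    have wy2: "w \<otimes> y \<in> two_torsion G"
      using two_torsion_commute yc wc yw by auto
    have "w \<otimes> y \<noteq> \<one>"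
      using yc wc yw(2) by (auto simp: mult_eq_one_iff)
    then have "\<sigma> (w \<otimes> y) \<noteq> \<one>"
      using \<sigma>inj[of "w \<otimes> y" \<one>] \<sigma>1 yc wc by simp
    moreover have "\<sigma> (w \<otimes> y) \<in> two_torsion G"
      using two_torsion_conj[OF z(1) wy2] wy2 by (simp add: \<sigma>_def two_torsion_inv)
    ultimately show ?thesis
      unfolding co_nbrs_POE[OF exp \<sigma>v[OF yc]]
      using \<sigma>v[OF wc] eq \<open>w \<noteq> y\<close> \<sigma>inj[of w y] wc yc by simp
  qed
  ultimately have "\<sigma> y \<in> co_dist2 ?D z"
    using \<sigma>v[OF yc] unfolding co_dist2_def pverts_POE by blast
  then have "\<sigma> y = y" using unique y by blast
  then have "z \<otimes> y = inv (z \<otimes> y)" using z\<sigma>[of y] yc by simp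
  then have "(z \<otimes> y) \<otimes> (z \<otimes> y) = \<one>" using yc by (simp add: mult_eq_one_iff)
  then show False using nzy yc by (simp add: two_torsion_def)
qed

section \<open>From the isomorphism to the subgroup structure\<close>

lemma poe_structure_if_iso:
  assumes fin: "finite (carrier G)" and ord: "order G = 2 ^ n"
    and h: "even h" "h \<ge> 2"
    and iso: "proper_POE_complement_graph G \<cong>\<^sub>g X_graph h r"
  shows "poe_structure G h r"
proof -
  let ?D = "proper_POE_complement_graph G"
  let ?X = "X_graph h r"
  let ?T = "two_torsion G"
  have exp: "\<forall>x\<in>carrier G. x [^] (2 ^ n :: nat) = \<one>"
    using pow_order_eq_1 ord by simp
  interpret D: pair_graph ?D
    by (rule pair_graph_proper_POE_complement_graph[OF is_group fin])
  interpret X: pair_graph ?X by (rule pair_graph_X_graph)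
  obtain f where f: "bij_betw f (pverts ?D) (pverts ?X)"
    and adj: "\<And>x y. x \<in> pverts ?D \<Longrightarrow> y \<in> pverts ?D \<Longrightarrow> (x, y) \<in> parcs ?D \<longleftrightarrow> (f x, f y) \<in> parcs ?X"
    using iso graph_iso_iff[OF D.pair_wf_digraph_axioms X.pair_wf_digraph_axioms] by blast
  have finT: "finite ?T" using two_torsion_subset fin finite_subset by blast
  have fx: "f x \<in> pverts ?X" if "x \<in> carrier G - {\<one>}" for x
    using f that by (auto simp: bij_betw_def pverts_POE)
  have deg: "card (?T - {\<one>, x, x \<otimes> x}) = h - 2" if x: "x \<in> carrier G - {\<one>}" for x
  proof -
    have xv: "x \<in> pverts ?D" using x by (simp add: pverts_POE)
    have "inj_on f (co_nbrs ?D x)"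
      using f by (auto simp: bij_betw_def co_nbrs_def intro: inj_on_subset)
    then have "card (co_nbrs ?D x) = card (co_nbrs ?X (f x))"
      using co_nbrs_iso[OF f adj xv] by (simp add: card_image)
    then show ?thesis
      using card_co_nbrs_X_graph[OF h(1) fx[OF x]] card_co_nbrs_POE[OF exp x] by simp
  qed
  have "card (carrier G) - 1 = (r + 1) * h - 1"
    using bij_betw_same_card[OF f] card_pverts_X_graph[OF h] fin by (simp add: pverts_POE)
  moreover have "(r + 1) * h \<ge> 2" using h(2) by simp
  moreover have "card (carrier G) > 0" using fin card_gt_0_iff by blast
  ultimately have order: "order G = (r + 1) * h" unfolding order_def by linarith
  then obtain z where z: "z \<in> ?T" "z \<noteq> \<one>"
    using exists_involution[OF fin] h(1) by auto
  \<comment> \<open>For an involution, \<open>z \<otimes> z = \<one>\<close>, so the degree formula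
    removes only two elements of \<open>?T\<close>.\<close>
  have "card (?T - {\<one>, z}) = h - 2"
    using deg[of z] z by (auto simp: two_torsion_def insert_commute)
  moreover have "card ?T = card (?T - {\<one>, z}) + 2"
    using z one_two_torsion card_Diff_subset[of "{\<one>, z}" ?T] card_mono[OF finT, of "{\<one>, z}"] by auto
  ultimately have cardT: "card ?T = h" using h(2) by simp
  have square: "x \<otimes> x \<in> ?T" if x: "x \<in> carrier G" for x
  proof (rule ccontr)
    assume a: "x \<otimes> x \<notin> ?T"
    then have "x \<notin> ?T" using one_two_torsion by (auto simp: two_torsion_def)
    \<comment> \<open>Now only one element of \<open>?T\<close> is removed, so the degree of
      \<open>x\<close> would be \<open>h - 1\<close> instead of \<open>h - 2\<close>.\<close>
    then have "?T - {\<one>, x, x \<otimes> x} = ?T - {\<one>}" "x \<noteq> \<one>" using a one_two_torsion by auto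
    then have "card (?T - {\<one>}) = h - 2" using deg[of x] x by auto
    then show False using cardT one_two_torsion finT h(2) by simp
  qed
  have empty: "co_dist2 ?X (f x) = {}" if x: "x \<in> ?T" "x \<noteq> \<one>" for x
  proof -
    have xv: "x \<in> pverts ?D" using x two_torsion_subset by (auto simp: pverts_POE)
    have sub: "co_dist2 ?D x \<subseteq> pverts ?D" by (auto simp: co_dist2_def)
    have eq: "co_dist2 ?X (f x) = f ` co_dist2 ?D x" by (rule co_dist2_iso[OF f adj xv])
    have "v = w" if "v \<in> co_dist2 ?D x" "w \<in> co_dist2 ?D x" for v w
    proof -
      have "f v = f w"
        using co_dist2_X_graph_unique[of "f x" h r "f v" "f w"] eq that fx xv
        by (auto simp: pverts_POE)
      then show ?thesis using f that sub by (auto simp: bij_betw_def dest: inj_onD)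
    qed
    then show ?thesis using co_dist2_involution_empty[OF exp x] eq by blast
  qed
  have "x \<otimes> y \<in> ?T" if x: "x \<in> ?T" and y: "y \<in> ?T" for x y
  proof (cases "x = \<one> \<or> y = \<one> \<or> x = y")
    case True
    then show ?thesis using x y one_two_torsion two_torsion_subset by (auto simp: two_torsion_def)
  next
    case False
    then have xv: "x \<in> carrier G - {\<one>}" and yv: "y \<in> carrier G - {\<one>}"
      using x y two_torsion_subset by auto
    \<comment> \<open>Two distinct involutions force \<open>h \<ge> 3\<close>, and parity then gives
      the bound \<open>h \<ge> 4\<close> required to recognise clique vertices.\<close>
    have "card {\<one>, x, y} \<le> h"
      unfolding cardT[symmetric] using finT x y one_two_torsion by (intro card_mono) auto
    then have "h \<ge> 3" using False by auto
    then have "h \<ge> 4" using h(1) by presburger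
    then have "f x \<in> range Inl" "f y \<in> range Inl"
      using co_dist2_X_graph_empty[of h "f x" r] co_dist2_X_graph_empty[of h "f y" r]
        fx xv yv empty x y False by auto
    then have "(f x, f y) \<notin> parcs ?X" by (auto simp: parcs_X_graph)
    then have "(x, y) \<notin> parcs ?D" using adj xv yv by (simp add: pverts_POE)
    then show ?thesis using False by (simp add: parcs_POE[OF exp xv yv])
  qed
  then show ?thesis using square cardT order by (simp add: poe_structure_def)
qed

end

section \<open>From the subgroup structure back to an isomorphism\<close>

lemma card_fibres:
  assumes "finite V" and k: "\<And>b. b \<in> g ` V \<Longrightarrow> card {x \<in> V. g x = b} = k"
  shows "card V = card (g ` V) * k"
proof -
  have "card V = (\<Sum>b\<in>g ` V. card {x \<in> V. g x = b})"
    using sum.image_gen[OF assms(1), of "\<lambda>_. 1::nat" g] by simp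
  then show ?thesis using k by simp
qed

text \<open>Number each fibre by a bijection with \<open>J\<close>; together with the fibre's name
  this determines a point. It supplies the coordinates within a coset and within an inverse
  pair.\<close>

lemma fibre_coordinate:
  assumes "finite V" "finite J" and k: "\<forall>b\<in>g ` V. card {x \<in> V. g x = b} = card J"
  shows "\<exists>\<psi>. \<psi> ` V \<subseteq> J \<and> inj_on (\<lambda>x. (g x, \<psi> x)) V"
proof -
  have "\<exists>\<phi>. bij_betw \<phi> {x \<in> V. g x = b} J" if "b \<in> g ` V" for b
    using finite_same_card_bij[of "{x \<in> V. g x = b}" J] assms that by simp
  then obtain \<phi> where \<phi>: "\<And>b. b \<in> g ` V \<Longrightarrow> bij_betw (\<phi> b) {x \<in> V. g x = b} J"
    by metis
  show ?thesis
  proof (intro exI conjI)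
    show "(\<lambda>x. \<phi> (g x) x) ` V \<subseteq> J"
      using \<phi> by (fastforce simp: bij_betw_def)
    show "inj_on (\<lambda>x. (g x, \<phi> (g x) x)) V"
    proof (rule inj_onI)
      fix x y assume xy: "x \<in> V" "y \<in> V" "(g x, \<phi> (g x) x) = (g y, \<phi> (g y) y)"
      have "inj_on (\<phi> (g x)) {v \<in> V. g v = g x}"
        using \<phi> xy(1) by (auto simp: bij_betw_def)
      then show "x = y" by (rule inj_onD) (use xy in auto)
    qed
  qed
qed

text \<open>All squares in the elementary abelian factor are trivial, so the two-torsion of the
  product is \<open>two_torsion G \<times> carrier ?E\<close>. Its size grows by
  \<open>2 ^ t\<close> while its index stays \<open>r + 1\<close>.\<close>

lemma poe_structure_DirProd:
  assumes "group G" "poe_structure G h r"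
  shows "poe_structure (G \<times>\<times> elementary_abelian_2_group t) (2 ^ t * h) r"
proof -
  let ?E = "elementary_abelian_2_group t"
  interpret G: group G by fact
  interpret E: group ?E by (simp add: elementary_abelian_2_group_def)
  have card: "card (carrier ?E) = 2 ^ t"
    by (simp add: elementary_abelian_2_group_def carrier_integer_mod_group card_PiE)
  have sq: "x \<otimes>\<^bsub>?E\<^esub> x = \<one>\<^bsub>?E\<^esub>" for x
    by (auto simp: elementary_abelian_2_group_def fun_eq_iff)
  have T: "two_torsion (G \<times>\<times> ?E) = two_torsion G \<times> carrier ?E"
    by (auto simp: two_torsion_def DirProd_def sq)
  show ?thesis
    using assms(2) unfolding poe_structure_def T order_def
    by (auto simp: card_cartesian_product card DirProd_def algebra_simps)
qed

lemma (in group) iso_if_poe_structure: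
  assumes fin: "finite (carrier G)" and h: "even h" "h \<ge> 2"
    and str: "poe_structure G h r"
  shows "proper_POE_complement_graph G \<cong>\<^sub>g X_graph h r"
proof -
  let ?D = "proper_POE_complement_graph G"
  let ?X = "X_graph h r"
  let ?T = "two_torsion G"
  have closed: "x \<otimes> y \<in> ?T" if "x \<in> ?T" "y \<in> ?T" for x y
    using str that by (simp add: poe_structure_def)
  have square: "x \<otimes> x \<in> ?T" if "x \<in> carrier G" for x
    using str that by (simp add: poe_structure_def)
  have cardT: "card ?T = h" and order: "order G = (r + 1) * h"
    using str by (simp_all add: poe_structure_def)
  have exp: "\<forall>x\<in>carrier G. x [^] (2 ^ 2 :: nat) = \<one>"
  proof
    fix x assume x: "x \<in> carrier G"
    have "x [^] (2 ^ 2 :: nat) = (x \<otimes> x) \<otimes> (x \<otimes> x)"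
      using x by (simp add: numeral_eq_Suc m_assoc)
    then show "x [^] (2 ^ 2 :: nat) = \<one>" using square[OF x] by (simp add: two_torsion_def)
  qed
  have finT: "finite ?T" using two_torsion_subset fin finite_subset by blast
  define V where "V = carrier G - ?T"
  have finV: "finite V" using fin by (simp add: V_def)
  have V: "x \<in> carrier G" "x \<noteq> \<one>" "x \<notin> ?T" if "x \<in> V" for x
    using that one_two_torsion by (auto simp: V_def)
  have cardV: "card V = r * h"
    using order cardT fin finT two_torsion_subset
    by (simp add: V_def card_Diff_subset order_def)
  \<comment> \<open>This is the coset of \<open>inv x\<close>, which is also that of
    \<open>x\<close> because \<open>?T\<close> contains all squares. The pairs
    \<open>\<pi> x\<close> become the copies of \<open>K_2\<close>.\<close>
  define \<kappa> where "\<kappa> = (\<lambda>x. {y \<in> carrier G. x \<otimes> y \<in> ?T})"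
  define \<pi> where "\<pi> = (\<lambda>x. {x, inv x})"
  have trans: "x \<otimes> z \<in> ?T"
    if [simp]: "x \<in> carrier G" "y \<in> carrier G" "z \<in> carrier G"
      and xy: "x \<otimes> y \<in> ?T" and yz: "y \<otimes> z \<in> ?T" for x y z
  proof -
    \<comment> \<open>Inserting the inverse square between \<open>x \<otimes> y\<close> and
      \<open>y \<otimes> z\<close> cancels both copies of \<open>y\<close>.\<close>
    have "inv (y \<otimes> y) \<in> ?T" using square by (simp add: inv_in_two_torsion_iff)
    then have "(x \<otimes> y) \<otimes> inv (y \<otimes> y) \<otimes> (y \<otimes> z) \<in> ?T" using that closed by blast
    moreover have "(x \<otimes> y) \<otimes> inv (y \<otimes> y) \<otimes> (y \<otimes> z) = x \<otimes> (y \<otimes> inv y) \<otimes> (inv y \<otimes> y) \<otimes> z"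
      by (simp only: inv_mult_group m_assoc m_closed inv_closed that)
    ultimately show ?thesis by simp
  qed
  have \<kappa>_eq: "\<kappa> x = \<kappa> y \<longleftrightarrow> x \<otimes> y \<in> ?T" if x: "x \<in> carrier G" and y: "y \<in> carrier G" for x y
  proof
    assume "\<kappa> x = \<kappa> y"
    moreover have "y \<in> \<kappa> y" using y square by (simp add: \<kappa>_def)
    ultimately show "x \<otimes> y \<in> ?T" by (auto simp: \<kappa>_def)
  next
    assume a: "x \<otimes> y \<in> ?T"
    then have "y \<otimes> x \<in> ?T" using two_torsion_commute x y by blast
    have "x \<otimes> v \<in> ?T \<longleftrightarrow> y \<otimes> v \<in> ?T" if "v \<in> carrier G" for v
      using trans[OF x y that a] trans[OF y x that \<open>y \<otimes> x \<in> ?T\<close>] by blast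
    then show "\<kappa> x = \<kappa> y" by (auto simp: \<kappa>_def)
  qed
  have \<kappa>_inv: "\<kappa> (inv x) = \<kappa> x" if "x \<in> carrier G" for x
    using that \<kappa>_eq[of "inv x" x] one_two_torsion by simp
  have \<kappa>_fibre: "card {y \<in> V. \<kappa> y = \<kappa> x} = h" if x: "x \<in> V" for x
  proof -
    have "bij_betw (\<lambda>s. inv x \<otimes> s) ?T {y \<in> V. \<kappa> y = \<kappa> x}"
    proof (rule bij_betwI[where g = "\<lambda>y. x \<otimes> y"])
      show "(\<lambda>s. inv x \<otimes> s) \<in> ?T \<rightarrow> {y \<in> V. \<kappa> y = \<kappa> x}"
      proof
        fix s assume s: "s \<in> ?T"
        then have sc: "s \<in> carrier G" using two_torsion_subset by auto
        have xs: "x \<otimes> (inv x \<otimes> s) = s" using V(1)[OF x] sc by (simp add: m_assoc[symmetric])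
        have "inv x \<otimes> s \<notin> ?T"
        proof
          assume "inv x \<otimes> s \<in> ?T"
          then have "(inv x \<otimes> s) \<otimes> s \<in> ?T" using closed s by blast
          moreover have "(inv x \<otimes> s) \<otimes> s = inv x"
            using s sc V(1)[OF x] by (simp add: m_assoc two_torsion_def)
          ultimately show False using V[OF x] by (simp add: inv_in_two_torsion_iff)
        qed
        moreover have "\<kappa> x = \<kappa> (inv x \<otimes> s)"
          using \<kappa>_eq[of x "inv x \<otimes> s"] xs s sc V(1)[OF x] by simp
        ultimately show "inv x \<otimes> s \<in> {y \<in> V. \<kappa> y = \<kappa> x}"
          using sc V(1)[OF x] by (simp add: V_def)
      qed
      show "(\<lambda>y. x \<otimes> y) \<in> {y \<in> V. \<kappa> y = \<kappa> x} \<rightarrow> ?T"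
        using \<kappa>_eq V(1) x by blast
    qed (use V(1) x two_torsion_subset in \<open>auto simp: m_assoc[symmetric]\<close>)
    then show ?thesis using bij_betw_same_card cardT by fastforce
  qed
  have inv_V: "inv x \<in> V" "inv x \<noteq> x" if x: "x \<in> V" for x
  proof -
    show "inv x \<in> V" using V[OF x] by (simp add: V_def inv_in_two_torsion_iff)
    show "inv x \<noteq> x"
    proof
      assume "inv x = x"
      then have "x \<otimes> x = \<one>" using V[OF x] by (simp add: mult_eq_one_iff)
      then show False using V[OF x] by (simp add: two_torsion_def)
    qed
  qed
  have \<pi>_eq: "\<pi> y = \<pi> x \<longleftrightarrow> y = x \<or> y = inv x" if "x \<in> V" "y \<in> V" for x y
    using that V(1) unfolding \<pi>_def by (auto simp: doubleton_eq_iff)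
  have \<pi>_fibre: "card {y \<in> V. \<pi> y = p} = card {..<2::nat}" if p: "p \<in> \<pi> ` V" for p
  proof -
    obtain x where x: "x \<in> V" "p = \<pi> x" using p by blast
    then have "{y \<in> V. \<pi> y = p} = {x, inv x}" using \<pi>_eq inv_V by auto
    then show ?thesis using inv_V(2)[OF x(1)] by simp
  qed
  \<comment> \<open>The coset of an inverse pair: both members have the same
    \<open>\<kappa>\<close>, so the union is that common value.\<close>
  define \<kappa>' where "\<kappa>' = (\<lambda>p. \<Union> (\<kappa> ` p))"
  have \<kappa>'_\<pi>: "\<kappa>' (\<pi> x) = \<kappa> x" if "x \<in> V" for x
    using \<kappa>_inv V(1)[OF that] by (simp add: \<kappa>'_def \<pi>_def)
  have \<kappa>'_fibre: "card {p \<in> \<pi> ` V. \<kappa>' p = c} = card {1..h div 2}"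
    if c: "c \<in> \<kappa>' ` \<pi> ` V" for c
  proof -
    obtain x where x: "x \<in> V" "c = \<kappa> x" using c \<kappa>'_\<pi> by auto
    let ?F = "{y \<in> V. \<kappa> y = c}"
    have img: "\<pi> ` ?F = {p \<in> \<pi> ` V. \<kappa>' p = c}" using \<kappa>'_\<pi> by auto
    have "card ?F = card (\<pi> ` ?F) * 2"
    proof (rule card_fibres)
      fix p assume p: "p \<in> \<pi> ` ?F"
      then have "\<kappa>' p = c" "p \<in> \<pi> ` V" using \<kappa>'_\<pi> by auto
      then have "{y \<in> ?F. \<pi> y = p} = {y \<in> V. \<pi> y = p}"
        using \<kappa>'_\<pi>[symmetric] by auto
      then show "card {y \<in> ?F. \<pi> y = p} = 2" using \<pi>_fibre[OF \<open>p \<in> \<pi> ` V\<close>] by simp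
    qed (use finV in simp)
    then show ?thesis using \<kappa>_fibre[OF x(1)] x(2) img by simp
  qed
  have "card V = card (\<kappa> ` V) * h"
    using card_fibres[OF finV, of \<kappa> h] \<kappa>_fibre by blast
  then have "card (\<kappa> ` V) = card {1..r}" using cardV h(2) by simp
  then obtain \<iota> where \<iota>: "bij_betw \<iota> (\<kappa> ` V) {1..r}"
    using finite_same_card_bij[of "\<kappa> ` V" "{1..r}"] finV by auto
  obtain \<psi> where \<psi>: "\<psi> ` V \<subseteq> {..<2::nat}" "inj_on (\<lambda>x. (\<pi> x, \<psi> x)) V"
    using fibre_coordinate[OF finV finite_lessThan ballI[OF \<pi>_fibre]] by auto
  obtain \<theta> where \<theta>: "\<theta> ` \<pi> ` V \<subseteq> {1..h div 2}" "inj_on (\<lambda>p. (\<kappa>' p, \<theta> p)) (\<pi> ` V)"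
    using fibre_coordinate[OF finite_imageI[OF finV] finite_atLeastAtMost ballI[OF \<kappa>'_fibre]]
    by auto
  have "card (?T - {\<one>}) = card {..<h - 1}"
    using cardT one_two_torsion finT by simp
  then obtain \<alpha> where \<alpha>: "bij_betw \<alpha> (?T - {\<one>}) {..<h - 1}"
    using finite_same_card_bij[of "?T - {\<one>}" "{..<h - 1}"] finT by auto
  text \<open>The coordinates of \<open>x \<notin> T\<close> are its coset, its pair \<open>{x, x\<inverse>}\<close> within the coset, and its
    position in the pair.\<close>
  define F where "F = (\<lambda>x. if x \<in> ?T then Inl (\<alpha> x) else Inr (\<iota> (\<kappa> x), \<theta> (\<pi> x), \<psi> x))"
  have FT: "F x = Inl (\<alpha> x)" if "x \<in> ?T" for x using that by (simp add: F_def)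
  have FV: "F x = Inr (\<iota> (\<kappa> x), \<theta> (\<pi> x), \<psi> x)" if "x \<in> V" for x
    using V(3)[OF that] by (simp add: F_def)
  have split: "x \<in> ?T - {\<one>} \<or> x \<in> V" if "x \<in> carrier G - {\<one>}" for x
    using that by (auto simp: V_def)
  have \<iota>_eq: "\<iota> (\<kappa> x) = \<iota> (\<kappa> y) \<longleftrightarrow> \<kappa> x = \<kappa> y" if "x \<in> V" "y \<in> V" for x y
    using \<iota> that by (auto simp: bij_betw_def dest: inj_onD)
  have \<theta>_eq: "\<theta> (\<pi> x) = \<theta> (\<pi> y) \<longleftrightarrow> \<pi> x = \<pi> y" if "x \<in> V" "y \<in> V" "\<kappa> x = \<kappa> y" for x y
    using inj_onD[OF \<theta>(2), of "\<pi> x" "\<pi> y"] that \<kappa>'_\<pi> by auto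
  have \<psi>_eq: "\<psi> x = \<psi> y \<longleftrightarrow> x = y" if "x \<in> V" "y \<in> V" "\<pi> x = \<pi> y" for x y
    using inj_onD[OF \<psi>(2), of x y] that by auto
  have Fin: "F x \<in> pverts ?X" if "x \<in> carrier G - {\<one>}" for x
    using split[OF that]
  proof
    assume "x \<in> ?T - {\<one>}"
    then show ?thesis using \<alpha> by (auto simp: FT pverts_X_graph bij_betw_def)
  next
    assume "x \<in> V"
    then show ?thesis using \<iota> \<theta>(1) \<psi>(1) by (auto simp: FV pverts_X_graph bij_betw_def)
  qed
  have inj: "inj_on F (carrier G - {\<one>})"
  proof (rule inj_onI)
    fix x y assume xy: "x \<in> carrier G - {\<one>}" "y \<in> carrier G - {\<one>}" "F x = F y"
    show "x = y"
    proof (cases "x \<in> ?T")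
      case True
      then have "y \<in> ?T" using xy(3) by (auto simp: F_def split: if_splits)
      then show ?thesis using True xy \<alpha> by (auto simp: FT bij_betw_def dest: inj_onD)
    next
      case False
      then have "x \<in> V" "y \<in> V" using xy by (auto simp: F_def V_def split: if_splits)
      then show ?thesis using xy(3) \<iota>_eq \<theta>_eq \<psi>_eq by (auto simp: FV)
    qed
  qed
  \<comment> \<open>Equal cardinalities turn injectivity of \<open>F\<close> into
    bijectivity.\<close>
  have "card (pverts ?X) = card (carrier G - {\<one>})"
    using card_pverts_X_graph[OF h] order fin by (simp add: order_def)
  moreover have "finite (pverts ?X)" by (simp add: pverts_X_graph)
  ultimately have bij: "bij_betw F (pverts ?D) (pverts ?X)"
    using inj Fin card_subset_eq[of "pverts ?X" "F ` (carrier G - {\<one>})"]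
    by (auto simp: bij_betw_def pverts_POE card_image)
  have adj: "(x, y) \<in> parcs ?D \<longleftrightarrow> (F x, F y) \<in> parcs ?X"
    if xy: "x \<in> carrier G - {\<one>}" "y \<in> carrier G - {\<one>}" for x y
  proof -
    have eq1: "x \<otimes> y = \<one> \<longleftrightarrow> y = inv x"
      using xy by (simp add: mult_eq_one_iff)
    note D = parcs_POE[OF exp xy]
    consider "x \<in> ?T" "y \<in> ?T" | "x \<in> ?T" "y \<in> V" | "x \<in> V" "y \<in> ?T" | "x \<in> V" "y \<in> V"
      using split xy by blast
    then show ?thesis
    proof cases
      case 1
      \<comment> \<open>In \<open>?T\<close> a product is \<open>\<one>\<close> only for equal
        factors, so distinct vertices are never adjacent.\<close>
      then show ?thesis using closed D eq1 two_torsion_inv by (auto simp: FT parcs_X_graph)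
    next
      case 2
      have "x \<otimes> y \<notin> ?T"
      proof
        assume "x \<otimes> y \<in> ?T"
        then have "x \<otimes> (x \<otimes> y) \<in> ?T" using closed 2 by blast
        then show False using 2 V[of y] by (simp add: m_assoc[symmetric] two_torsion_def)
      qed
      then show ?thesis
        using 2 D V(3) Fin[OF xy(1)] Fin[OF xy(2)] FT[of x] FV[of y] by (auto simp: parcs_X_graph)
    next
      case 3
      have "x \<otimes> y \<notin> ?T"
      proof
        assume "x \<otimes> y \<in> ?T"
        then have "x \<otimes> y \<otimes> y \<in> ?T" using closed 3 by blast
        then show False using 3 V[of x] by (simp add: m_assoc two_torsion_def)
      qed
      then show ?thesis
        using 3 D V(3) Fin[OF xy(1)] Fin[OF xy(2)] FV[of x] FT[of y] by (auto simp: parcs_X_graph)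
    next
      case 4
      have X: "(F x, F y) \<in> parcs ?X \<longleftrightarrow>
          \<iota> (\<kappa> x) \<noteq> \<iota> (\<kappa> y) \<or> \<theta> (\<pi> x) = \<theta> (\<pi> y) \<and> \<psi> x \<noteq> \<psi> y"
        using Fin[OF xy(1)] Fin[OF xy(2)] by (simp add: FV 4 parcs_X_graph)
      show ?thesis
      proof (cases "x \<otimes> y \<in> ?T")
        case True
        then have "\<kappa> x = \<kappa> y" using \<kappa>_eq 4 V(1) by blast
        \<comment> \<open>Within one coset the edges of \<open>?X\<close> join the ends of a pair,
          that is \<open>y = inv x\<close>, which is the exception
          \<open>x \<otimes> y = \<one>\<close> in \<open>D\<close>.\<close>
        then have "(F x, F y) \<in> parcs ?X \<longleftrightarrow> \<pi> x = \<pi> y \<and> x \<noteq> y"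
          using X \<theta>_eq \<psi>_eq 4 by auto
        then show ?thesis using D True eq1 \<pi>_eq[of x y] 4 by auto
      next
        case False
        then have "\<kappa> x \<noteq> \<kappa> y" using \<kappa>_eq 4 V(1) by blast
        moreover have "x \<noteq> y" using False square xy by auto
        ultimately show ?thesis using D False X \<iota>_eq 4 by auto
      qed
    qed
  qed
  interpret D: pair_graph ?D
    by (rule pair_graph_proper_POE_complement_graph[OF is_group fin])
  interpret X: pair_graph ?X by (rule pair_graph_X_graph)
  show ?thesis
    unfolding graph_iso_iff[OF D.pair_wf_digraph_axioms X.pair_wf_digraph_axioms]
    using bij adj by (auto simp: pverts_POE)
qed

theorem theorem6p3:
  fixes G :: "('a, 'b) monoid_scheme" and h r t :: nat
  assumes "group G" and "finite (carrier G)" and "\<exists>n. order G = 2 ^ n"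
    and "even h" and "h \<ge> 2" and "r \<ge> 1"
    and "proper_POE_complement_graph G \<cong>\<^sub>g X_graph h r"
  shows "proper_POE_complement_graph (G \<times>\<times> elementary_abelian_2_group t) \<cong>\<^sub>g X_graph (2 ^ t * h) r"
proof -
  let ?E = "elementary_abelian_2_group t"
  interpret G: group G by fact
  interpret E: group ?E by (simp add: elementary_abelian_2_group_def)
  interpret P: group "G \<times>\<times> ?E" by (rule DirProd_group) unfold_locales
  have "poe_structure G h r"
    using assms(3) G.poe_structure_if_iso[OF assms(2) _ assms(4,5,7)] by blast
  then have "poe_structure (G \<times>\<times> ?E) (2 ^ t * h) r"
    by (rule poe_structure_DirProd[OF assms(1)])
  moreover have "finite (carrier ?E)"
    by (simp add: elementary_abelian_2_group_def carrier_integer_mod_group finite_PiE)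
  then have "finite (carrier (G \<times>\<times> ?E))"
    using assms(2) by (simp add: DirProd_def)
  moreover have "2 ^ t * h \<ge> 2"
    using assms(5) by (metis le_trans mult_le_mono1 nat_mult_1 one_le_numeral one_le_power)
  ultimately show ?thesis
    using P.iso_if_poe_structure assms(4) by simp
qed

end
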